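(* For all integers $n\ge 3$, \[ 2\cdot M(n)\le M(n+1). \]
   Context: For a finite simple graph $G$ on vertex set $[n]$, $P_G=\operatorname{conv}\{\pm(e_i-e_j):\{i,j\}\in E(G)\}\subset\mathbb{R}^n$ is the symmetric edge polytope, and $N(P)$ is the number of facets of a polytope $P$. With $C_m$ the $m$-edge cycle, $e$ a single edge, and $\vee$ denoting a wedge (identification of one vertex from each graph), $M(n)=N(P_G)$ where $G=C_{k+1}\vee C_{k-1}$ if $n=2k-1$, $k$ even; $G=C_k\vee C_k$ if $n=2k-1$, $k$ odd; $G=C_{k+1}\vee C_{k-1}\vee e$ if $n=2k$, $k$ even; $G=C_k\vee C_k\vee e$ if $n=2k$, $k$ odd. Equivalently, $M(2k-1)=(k+1)(k-1)\binom{k}{k/2}\binom{k-2}{(k-2)/2}$ for $k$ even, $M(2k-1)=k^2\binom{k-1}{(k-1)/2}^2$ for $k$ odd, and $M(2k)=2M(2k-1)$; for $n=3,4$ (where the graph definition formally involves $C_1$) these formulas serve as the definition, giving $M(3)=6$, $M(4)=12$. *)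

theory Defs
  imports "HOL-Analysis.Analysis" "HOL-Analysis.Finite_Function_Topology"
begin

text \<open>A graph is a pair of a vertex set and a set of edges, each edge being a two-element set
  of vertices.\<close>

type_synonym 'v graph = "'v set \<times> 'v set set"

abbreviation verts :: "'v graph \<Rightarrow> 'v set" where
  "verts G \<equiv> fst G"

abbreviation edges :: "'v graph \<Rightarrow> 'v set set" where
  "edges G \<equiv> snd G"

definition graph_iso :: "'v graph \<Rightarrow> 'w graph \<Rightarrow> bool" where
  "graph_iso G H \<longleftrightarrow>
     (\<exists>f. bij_betw f (verts G) (verts H) \<and> edges H = (\<lambda>e. f ` e) ` edges G)"

text \<open>The \<open>m\<close>-edge cycle on \<open>{1..m}\<close>; it is a simple graph for \<open>m \<ge> 3\<close>.\<close>

definition cycle_graph :: "nat \<Rightarrow> nat graph" where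
  "cycle_graph m = ({1..m}, {{i, i + 1} | i. 1 \<le> i \<and> i < m} \<union> {{m, 1}})"

definition single_edge :: "nat graph" where
  "single_edge = ({1, 2}, {{1, 2}})"

text \<open>The notation \<open>G \<or> H\<close> for a wedge does not name the vertices that are identified, so
  \<open>is_wedge G H W\<close> says that \<open>W\<close> is a wedge of \<open>G\<close> and \<open>H\<close> for some choice of one vertex from
  each: \<open>W\<close> is the union of a copy of \<open>G\<close> and a copy of \<open>H\<close> sharing exactly one vertex.\<close>

definition is_wedge :: "'v graph \<Rightarrow> 'v graph \<Rightarrow> 'v graph \<Rightarrow> bool" where
  "is_wedge G H W \<longleftrightarrow>
     (\<exists>A B x. graph_iso G A \<and> graph_iso H B \<and> verts A \<inter> verts B = {x} \<and>
        W = (verts A \<union> verts B, edges A \<union> edges B))"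

text \<open>Since the dimension \<open>n\<close> varies, \<open>\<real>\<^sup>n\<close> is modelled as the space of finitely supported functions
  \<open>nat \<Rightarrow>\<^sub>0 real\<close> with support in \<open>{1..n}\<close>. The polytope below lies in this
  subspace if \<open>verts G = {1..n}\<close>, and its faces do not depend on the surrounding space.\<close>

definition std_basis :: "nat \<Rightarrow> (nat \<Rightarrow>\<^sub>0 real)" where
  "std_basis i = Poly_Mapping.single i 1"

definition sym_edge_polytope :: "nat graph \<Rightarrow> (nat \<Rightarrow>\<^sub>0 real) set" where
  "sym_edge_polytope G = convex hull
     ({std_basis i - std_basis j | i j. {i, j} \<in> edges G} \<union>
      {- (std_basis i - std_basis j) | i j. {i, j} \<in> edges G})"

text \<open>The library's \<open>aff_dim\<close> and \<open>facet_of\<close> are restricted to \<open>euclidean_space\<close>. For nonempty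
  sets, \<open>affine_dim\<close> is the dimension of the linear space parallel to the affine hull.\<close>

definition affine_dim :: "'a::real_vector set \<Rightarrow> nat" where
  "affine_dim S = dim {x - y | x y. x \<in> S \<and> y \<in> S}"

definition is_facet :: "'a::real_vector set \<Rightarrow> 'a set \<Rightarrow> bool" where
  "is_facet F P \<longleftrightarrow> F face_of P \<and> F \<noteq> {} \<and> affine_dim F + 1 = affine_dim P"

definition num_facets :: "'a::real_vector set \<Rightarrow> nat" where
  "num_facets P = card {F. is_facet F P}"

definition M_graph :: "nat \<Rightarrow> nat graph \<Rightarrow> bool" where
  "M_graph n G \<longleftrightarrow> verts G = {1..n} \<and>
     (\<exists>k. (n + 1 = 2 * k \<and> even k \<and> is_wedge (cycle_graph (k + 1)) (cycle_graph (k - 1)) G) \<or>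
          (n + 1 = 2 * k \<and> odd k \<and> is_wedge (cycle_graph k) (cycle_graph k) G) \<or>
          (n = 2 * k \<and> even k \<and>
             (\<exists>W. is_wedge (cycle_graph (k + 1)) (cycle_graph (k - 1)) W \<and>
                  is_wedge W single_edge G)) \<or>
          (n = 2 * k \<and> odd k \<and>
             (\<exists>W. is_wedge (cycle_graph k) (cycle_graph k) W \<and> is_wedge W single_edge G)))"

text \<open>For \<open>n = 3\<close> and \<open>n = 4\<close> (where \<open>k = 2\<close>) the graph would involve a one-edge cycle; there the
  closed formula \<open>M (2 * k - 1) = (k + 1) * (k - 1) * (k choose (k div 2)) *
  ((k - 2) choose ((k - 2) div 2))\<close> and \<open>M (2 * k) = 2 * M (2 * k - 1)\<close> is the definition.
  For \<open>n \<ge> 5\<close> the description operator expresses that the number of facets is the same for all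
  admissible graphs; it is not a meaningful value unless this is the case.\<close>

definition M :: "nat \<Rightarrow> nat" where
  "M n = (if n = 3 then (2 + 1) * (2 - 1) * (2 choose 1) * (0 choose 0)
          else if n = 4 then 2 * ((2 + 1) * (2 - 1) * (2 choose 1) * (0 choose 0))
          else (THE N. \<exists>G. M_graph n G \<and> N = num_facets (sym_edge_polytope G)))"

end

theory Submission
  imports Defs
begin

text \<open>
  A facet of the convex hull of a finite symmetric set \<open>X\<close> is cut out by a unique linear functional
  on the span of \<open>X\<close> that is at most \<open>1\<close> on \<open>X\<close> and takes the value \<open>1\<close> on a spanning
  subset of \<open>X\<close>. The edge vectors of the two graphs of a wedge span subspaces that meet only in
  \<open>0\<close>, so such functionals can be chosen independently on the two parts and the number of facets
  is multiplicative. All cycles in the definition of \<open>M\<close> are odd: a cycle with \<open>2 * l + 1\<close> edges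
  contributes the factor \<open>a l = (2 * l + 1) * (2 * l choose l)\<close>, and a single edge the factor
  \<open>2\<close>. Hence \<open>M n\<close> has the form \<open>a s * a t\<close> or \<open>2 * a s * a t\<close> with \<open>s = t\<close> or \<open>s = t + 1\<close>,
  and everything follows from \<open>4 * a t \<le> a (t + 1)\<close>.
\<close>

section \<open>Facets of symmetric polytopes\<close>

lemma dim_insert_finite_span:
  fixes U :: "'a::real_vector set"
  assumes "finite T" "U \<subseteq> span T" "p \<notin> span U"
  shows "dim (insert p U) = Suc (dim U)"
proof -
  obtain B where B: "B \<subseteq> U" "independent B" "U \<subseteq> span B" "card B = dim U"
    using basis_exists by blast
  have span_eq: "span B = span U"
    using B by (meson span_mono span_minimal subspace_span subset_antisym)
  have "finite B"
    using independent_span_bound[OF assms(1) B(2)] B(1) assms(2) by blast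
  moreover have "p \<notin> B"
    using assms(3) B(1) span_base by blast
  moreover have "independent (insert p B)"
    using B(2) assms(3) span_eq independent_insertI by metis
  moreover have "span (insert p B) = span (insert p U)"
    unfolding span_insert span_eq ..
  ultimately show ?thesis
    using dim_eq_card[of "insert p B" "insert p U"] B(4) by simp
qed

text \<open>A basis of \<open>B\<close> extends to a basis of \<open>span A\<close>; both are finite
  of the same cardinality, so the extension adds nothing.\<close>

lemma span_eq_if_dim_eq:
  fixes A B :: "'a::real_vector set"
  assumes "finite T" "A \<subseteq> span T" "B \<subseteq> span A" "dim B = dim A"
  shows "span B = span A"
proof -
  obtain C where C: "C \<subseteq> B" "independent C" "B \<subseteq> span C" "card C = dim B"
    using basis_exists by blast
  have "C \<subseteq> span A"
    using C(1) assms(3) by blast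
  then obtain D where D: "C \<subseteq> D" "D \<subseteq> span A" "independent D" "span A \<subseteq> span D"
    using maximal_independent_subset_extend[OF _ C(2)] by metis
  have "D \<subseteq> span T"
    using D(2) span_minimal[OF assms(2) subspace_span] by blast
  then have "finite D"
    using independent_span_bound[OF assms(1) D(3)] by blast
  moreover have "card D = dim A"
    using basis_card_eq_dim[OF D(2,4,3)] by simp
  ultimately have "C = D"
    using D(1) C(4) assms(4) card_subset_eq by metis
  then have "span A \<subseteq> span B"
    using D(4) span_mono[OF C(1)] by blast
  then show ?thesis
    using span_minimal[OF assms(3) subspace_span] by blast
qed

text \<open>Nonnegative multiples of differences are closed under addition: dividing by the sum of
  the two scalars turns the positive parts, and likewise the negative parts, into a convex
  combination of points of \<open>F\<close>.\<close>

lemma span_differences_convex: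
  fixes F :: "'a::real_vector set"
  assumes "convex F" "F \<noteq> {}" "v \<in> span {x - y | x y. x \<in> F \<and> y \<in> F}"
  shows "\<exists>t a b. t \<ge> 0 \<and> a \<in> F \<and> b \<in> F \<and> v = t *\<^sub>R (a - b)"
  using assms(3)
proof (induction rule: span_induct_alt)
  case base
  then show ?case using assms(2) by (metis ex_in_conv order_refl scaleR_zero_left)
next
  case (step c x y)
  obtain a0 b0 where x: "a0 \<in> F" "b0 \<in> F" "x = a0 - b0"
    using step.hyps(1) by blast
  obtain s a b where x': "s \<ge> 0" "a \<in> F" "b \<in> F" "c *\<^sub>R x = s *\<^sub>R (a - b)"
  proof (cases "c \<ge> 0")
    case True
    then show ?thesis using that x by blast
  next
    case False
    then have "c *\<^sub>R x = (-c) *\<^sub>R (b0 - a0)" using x(3) by (simp add: scaleR_diff_right)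
    then show ?thesis using that[of "-c" b0 a0] x False by auto
  qed
  obtain t a' b' where y: "t \<ge> 0" "a' \<in> F" "b' \<in> F" "y = t *\<^sub>R (a' - b')"
    using step.IH by blast
  show ?case
  proof (cases "s + t = 0")
    case True
    then have "s = 0" "t = 0" using x'(1) y(1) by auto
    then show ?thesis using x' y by (intro exI[of _ 0] exI[of _ a] exI[of _ b]) auto
  next
    case False
    then have pos: "s + t > 0" using x'(1) y(1) by auto
    define u where "u = s / (s + t)"
    define w where "w = t / (s + t)"
    have uw: "u \<ge> 0" "w \<ge> 0" "u + w = 1" "(s + t) * u = s" "(s + t) * w = t"
      unfolding u_def w_def using pos x'(1) y(1) by (auto simp flip: add_divide_distrib)
    have "u *\<^sub>R a + w *\<^sub>R a' \<in> F" "u *\<^sub>R b + w *\<^sub>R b' \<in> F"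
      using convexD[OF assms(1)] uw x' y by auto
    moreover have "c *\<^sub>R x + y = (s + t) *\<^sub>R ((u *\<^sub>R a + w *\<^sub>R a') - (u *\<^sub>R b + w *\<^sub>R b'))"
      using uw x'(4) y(4) by (simp add: scaleR_add_right scaleR_diff_right)
    ultimately show ?thesis using pos by (intro exI conjI) auto
  qed
qed

text \<open>The face axiom speaks of open segments, hence of distinct endpoints and two positive
  weights. This form also covers \<open>u = v\<close> and \<open>s = 0\<close>.\<close>

lemma face_of_convex_combinationD:
  fixes F P :: "'a::real_vector set"
  assumes "F face_of P" "u \<in> P" "v \<in> P" "0 < r" "0 \<le> s" "r + s = 1" "r *\<^sub>R u + s *\<^sub>R v \<in> F"
  shows "u \<in> F"
proof (cases "s = 0 \<or> u = v")
  case True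
  then show ?thesis using assms(6,7) by (auto simp flip: scaleR_add_left)
next
  case False
  then have "r *\<^sub>R u + s *\<^sub>R v \<in> open_segment u v"
    using assms(4-6) by (auto simp: in_segment intro!: exI[of _ s])
  then show ?thesis using assms face_ofD by blast
qed

section \<open>Facets recorded by the generators lying on them\<close>

text \<open>The level 1 is a normalisation of the supporting functional. A subset of
  \<open>X\<close> is recorded instead of \<open>g\<close> because \<open>g\<close> is determined on
  \<open>span X\<close> only.\<close>

definition facet_sets :: "'a::real_vector set \<Rightarrow> 'a set set" where
  "facet_sets X = {{x \<in> X. g x = 1} | g :: 'a \<Rightarrow> real.
     linear g \<and> (\<forall>x\<in>X. g x \<le> 1) \<and> span {x \<in> X. g x = 1} = span X}"

lemma span_convex_hull: "span (convex hull X) = span X" for X :: "'a::real_vector set"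
proof
  have "convex hull X \<subseteq> span X"
    by (simp add: hull_minimal span_superset convex_def span_add span_scale)
  then show "span (convex hull X) \<subseteq> span X"
    by (simp add: span_minimal)
  show "span X \<subseteq> span (convex hull X)"
    by (simp add: span_mono hull_subset)
qed

lemma linear_le_on_convex_hull:
  fixes g :: "'a::real_vector \<Rightarrow> real"
  assumes "linear g" "\<forall>x\<in>X. g x \<le> c" "x \<in> convex hull X"
  shows "g x \<le> c"
proof -
  have "convex (g -` {..c})"
    using assms(1) by (intro convex_linear_vimage) auto
  then have "convex hull X \<subseteq> g -` {..c}"
    using assms(2) by (intro hull_minimal) auto
  then show ?thesis using assms(3) by auto
qed

text \<open>In a convex combination at the maximal level \<open>c\<close>, the nonnegative terms
  \<open>u y * (c - g y)\<close> sum to 0, so only points at level \<open>c\<close> carry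
  weight.\<close>

lemma convex_hull_level_subset_span:
  fixes g :: "'a::real_vector \<Rightarrow> real"
  assumes g: "linear g" "\<forall>x\<in>X. g x \<le> c" and x: "x \<in> convex hull X" "g x = c"
  shows "x \<in> span {y \<in> X. g y = c}"
proof -
  obtain S u where S: "finite S" "S \<subseteq> X" "\<forall>y\<in>S. 0 \<le> u y" "sum u S = 1" "(\<Sum>y\<in>S. u y *\<^sub>R y) = x"
    using x(1) unfolding convex_hull_explicit by blast
  have "(\<Sum>y\<in>S. u y * (c - g y)) = c * sum u S - g (\<Sum>y\<in>S. u y *\<^sub>R y)"
    by (simp add: linear_sum[OF g(1)] linear_scale[OF g(1)] right_diff_distrib sum_subtractf
        sum_distrib_left mult.commute)
  also have "\<dots> = 0" using S x(2) by simp
  finally have 0: "\<forall>y\<in>S. u y * (c - g y) = 0"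
    using S g(2) by (subst (asm) sum_nonneg_eq_0_iff) auto
  have "(\<Sum>y\<in>S. u y *\<^sub>R y) \<in> span {y \<in> X. g y = c}"
  proof (rule span_sum)
    fix y assume "y \<in> S"
    then show "u y *\<^sub>R y \<in> span {y \<in> X. g y = c}"
      using 0 S(2) by (cases "u y = 0") (auto intro!: span_scale intro: span_base simp: span_zero)
  qed
  then show ?thesis using S by simp
qed

text \<open>Since \<open>x - (- x)\<close> is twice \<open>x\<close>, differences of points of the
  hull recover \<open>X\<close> up to scaling.\<close>

lemma affine_dim_symmetric:
  fixes X :: "'a::real_vector set"
  assumes "\<forall>x\<in>X. - x \<in> X"
  shows "affine_dim (convex hull X) = dim X"
proof -
  let ?D = "{x - y | x y. x \<in> convex hull X \<and> y \<in> convex hull X}"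
  have "span ?D = span X"
  proof
    show "span ?D \<subseteq> span X"
    proof (rule span_minimal[OF _ subspace_span])
      show "?D \<subseteq> span X"
        using span_convex_hull[of X] span_superset[of "convex hull X"] by (auto intro!: span_diff)
    qed
    show "span X \<subseteq> span ?D"
    proof (rule span_minimal[OF _ subspace_span], rule)
      fix x assume "x \<in> X"
      then have "x \<in> convex hull X" "- x \<in> convex hull X"
        using assms by (auto intro: hull_inc)
      then have "x - (- x) \<in> ?D" by blast
      then have "(1/2) *\<^sub>R (x - (- x)) \<in> span ?D"
        by (intro span_scale span_base)
      then show "x \<in> span ?D" by (simp flip: scaleR_2)
    qed
  qed
  then show ?thesis
    unfolding affine_dim_def by (rule span_eq_dim)
qed

text \<open>The bound on \<open>g\<close> makes the level set a face. \<open>g\<close> vanishes on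
  its directions \<open>?U\<close> but not on a generator \<open>s\<close> at level 1, and
  \<open>?U\<close> together with \<open>s\<close> spans \<open>X\<close>, so the dimension drops by
  exactly one.\<close>

lemma level_set_is_facet:
  fixes g :: "'a::real_vector \<Rightarrow> real"
  assumes X: "finite X" "\<forall>x\<in>X. - x \<in> X" "\<exists>x\<in>X. x \<noteq> 0"
    and g: "linear g" "\<forall>x\<in>X. g x \<le> 1" "span {x \<in> X. g x = 1} = span X"
  shows "is_facet {x \<in> convex hull X. g x = 1} (convex hull X)"
proof -
  let ?P = "convex hull X" and ?F = "{x \<in> convex hull X. g x = 1}"
  let ?U = "{x - y | x y. x \<in> ?F \<and> y \<in> ?F}"
  have face: "?F face_of ?P"
    unfolding face_of_def
  proof (intro conjI ballI impI)
    show "convex ?F"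
    proof -
      have "?F = ?P \<inter> g -` {1}" by auto
      then show ?thesis using g(1) by (simp add: convex_Int convex_linear_vimage)
    qed
  next
    fix a b x assume ab: "a \<in> ?P" "b \<in> ?P" "x \<in> ?F" "x \<in> open_segment a b"
    then obtain u where u: "0 < u" "u < 1" "x = (1 - u) *\<^sub>R a + u *\<^sub>R b"
      by (auto simp: in_segment)
    have "(1 - u) * (1 - g a) + u * (1 - g b) = 1 - g x"
      unfolding u(3) linear_add[OF g(1)] linear_scale[OF g(1)] by (simp add: algebra_simps)
    moreover have "g a \<le> 1" "g b \<le> 1"
      using linear_le_on_convex_hull[OF g(1,2)] ab by auto
    ultimately have "(1 - u) * (1 - g a) = 0 \<and> u * (1 - g b) = 0"
      using u ab(3) by (subst add_nonneg_eq_0_iff[symmetric]) auto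
    then show "a \<in> ?F" "b \<in> ?F" using ab u by auto
  qed auto
  \<comment> \<open>With no generator at level 1, \<open>span X\<close> would be trivial, against
    the nonzero element of \<open>X\<close>.\<close>
  have "{x \<in> X. g x = 1} \<noteq> {}"
  proof
    assume "{x \<in> X. g x = 1} = {}"
    then have "span X = {0}" using g(3) by (metis span_empty)
    then show False using X(3) span_base[of _ X] by auto
  qed
  then obtain s where s: "s \<in> X" "g s = 1" by blast
  have sF: "s \<in> ?F" using s by (auto intro: hull_inc)
  have U_span: "?U \<subseteq> span X"
    using span_convex_hull[of X] span_superset[of ?P] by (auto intro!: span_diff)
  have "s \<notin> span ?U"
  proof
    assume "s \<in> span ?U"
    moreover have "g x = 0" if "x \<in> ?U" for x
      using that by (auto simp: linear_diff[OF g(1)])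
    ultimately have "g s = 0"
      using linear_eq_0_on_span[OF g(1)] by blast
    then show False using s by simp
  qed
  then have dim_U: "dim (insert s ?U) = Suc (dim ?U)"
    by (rule dim_insert_finite_span[OF X(1) U_span])
  have "span (insert s ?U) = span X"
  proof
    show "span (insert s ?U) \<subseteq> span X"
      using U_span s by (intro span_minimal subspace_span) (auto intro: span_base)
    have "{x \<in> X. g x = 1} \<subseteq> span (insert s ?U)"
    proof
      fix x assume "x \<in> {x \<in> X. g x = 1}"
      then have "x - s \<in> ?U" using sF by (blast intro: hull_inc)
      then have "(x - s) + s \<in> span (insert s ?U)"
        by (intro span_add span_base) auto
      then show "x \<in> span (insert s ?U)" by simp
    qed
    then show "span X \<subseteq> span (insert s ?U)"
      unfolding g(3)[symmetric] by (intro span_minimal subspace_span)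
  qed
  then have "dim X = Suc (dim ?U)"
    using span_eq_dim[of "insert s ?U" X] dim_U by simp
  then have "affine_dim ?F + 1 = affine_dim ?P"
    using affine_dim_symmetric[OF X(2)] unfolding affine_dim_def by simp
  then show ?thesis
    unfolding is_facet_def using face sF by blast
qed

text \<open>Symmetry puts the origin in the polytope but on no proper face. A convex combination that
  gives the origin positive weight therefore avoids every facet, which makes the affine function
  cutting out the affine hull of a facet a supporting one.\<close>

lemma facet_supporting_functional:
  fixes X :: "'a::real_vector set"
  assumes X: "finite X" "\<forall>x\<in>X. - x \<in> X" and facet: "is_facet F (convex hull X)"
  obtains g :: "'a \<Rightarrow> real" where "linear g" "\<forall>x\<in>X. g x \<le> 1" "F = {x \<in> convex hull X. g x = 1}"
    "span {x \<in> X. g x = 1} = span X"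
proof -
  let ?P = "convex hull X"
  let ?U = "{x - y | x y. x \<in> F \<and> y \<in> F}"
  have face: "F face_of ?P" and ne: "F \<noteq> {}" and dimF: "Suc (dim ?U) = dim X"
    using facet affine_dim_symmetric[OF X(2)] unfolding is_facet_def affine_dim_def by auto
  have conv: "convex F" and sub: "F \<subseteq> ?P"
    using face unfolding face_of_def by auto
  note faceD = face_of_convex_combinationD[OF face]
  have P_span: "?P \<subseteq> span X"
    using span_convex_hull[of X] span_superset[of ?P] by auto
  have "X \<noteq> {}" using ne sub by auto
  then obtain x0 where x0: "x0 \<in> X" by blast
  have zero_P: "0 \<in> ?P"
  proof -
    have "(1/2) *\<^sub>R x0 + (1/2) *\<^sub>R (- x0) \<in> ?P"
      using x0 X(2) by (intro convexD[OF convex_convex_hull]) (auto intro: hull_inc)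
    then show ?thesis by simp
  qed
  \<comment> \<open>The origin is the midpoint of \<open>x\<close> and \<open>- x\<close>, so a face
    containing it contains all of \<open>X\<close> and is the whole polytope.\<close>
  have zero_F: "0 \<notin> F"
  proof
    assume "0 \<in> F"
    have "X \<subseteq> F"
    proof
      fix x assume "x \<in> X"
      then show "x \<in> F"
        using faceD[of x "- x" "1/2" "1/2"] X(2) \<open>0 \<in> F\<close> by (auto intro: hull_inc)
    qed
    then have "F = ?P" using conv sub by (simp add: hull_minimal subset_antisym)
    then have "affine_dim F = affine_dim ?P" by simp
    then show False using facet unfolding is_facet_def by simp
  qed
  obtain p where p: "p \<in> F" using ne by blast
  \<comment> \<open>If \<open>p = t *\<^sub>R (a - b)\<close>, then
    \<open>p + t *\<^sub>R b = t *\<^sub>R a\<close>. Divided by \<open>1 + t\<close>, the left side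
    is a point of \<open>F\<close> and the right side gives the origin positive weight.\<close>
  have p_notin: "p \<notin> span ?U"
  proof
    assume "p \<in> span ?U"
    then obtain t a b where t: "t \<ge> 0" "a \<in> F" "b \<in> F" "p = t *\<^sub>R (a - b)"
      using span_differences_convex[OF conv ne] by blast
    have "(1 / (1 + t)) *\<^sub>R p + (t / (1 + t)) *\<^sub>R b \<in> F"
      using t p by (intro convexD[OF conv]) (auto simp: field_simps)
    moreover have "(1 / (1 + t)) *\<^sub>R p + (t / (1 + t)) *\<^sub>R b
        = (1 / (1 + t)) *\<^sub>R 0 + (t / (1 + t)) *\<^sub>R a"
      using t(4) by (simp add: scaleR_diff_right)
    ultimately have "(1 / (1 + t)) *\<^sub>R 0 + (t / (1 + t)) *\<^sub>R a \<in> F" by metis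
    then have "0 \<in> F"
      using faceD[of 0 a "1 / (1 + t)" "t / (1 + t)"] zero_P sub t by (auto simp: field_simps)
    then show False using zero_F by blast
  qed
  have U_span: "?U \<subseteq> span X"
    using P_span sub by (auto intro!: span_diff)
  have "dim (insert p ?U) = dim X"
    using dim_insert_finite_span[OF X(1) U_span p_notin] dimF by simp
  then have span_U: "span (insert p ?U) = span X"
    using U_span p sub P_span X(1) by (intro span_eq_if_dim_eq[of X]) (auto simp: span_superset)
  \<comment> \<open>The functional is prescribed on a basis: 1 at \<open>p\<close> and 0 along the
    directions of \<open>F\<close>.\<close>
  obtain B where B: "B \<subseteq> ?U" "independent B" "?U \<subseteq> span B"
    using maximal_independent_subset by blast
  have "p \<notin> span B" using p_notin span_mono[OF B(1)] by blast
  then have "independent (insert p B)" using B(2) by (rule independent_insertI)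
  then obtain g :: "'a \<Rightarrow> real" where g: "linear g" "\<forall>x\<in>insert p B. g x = (if x = p then 1 else 0)"
    using linear_independent_extend[of "insert p B" "\<lambda>x. if x = p then 1 else 0"] by blast
  have gp: "g p = 1" using g by simp
  have gB: "g x = 0" if "x \<in> B" for x
    using g that \<open>p \<notin> span B\<close> span_base by fastforce
  have gU: "g x = 0" if "x \<in> ?U" for x
    using linear_eq_0_on_span[OF g(1) gB] B(3) that by blast
  \<comment> \<open>Modulo the directions of \<open>F\<close>, a point is a multiple of
    \<open>p\<close>, and \<open>g\<close> reads off the coefficient.\<close>
  have decomp: "\<exists>t a b. t \<ge> 0 \<and> a \<in> F \<and> b \<in> F \<and> x = g x *\<^sub>R p + t *\<^sub>R (a - b)" if "x \<in> ?P" for x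
  proof -
    have "x \<in> span (insert p ?U)" using that P_span span_U by blast
    then obtain c where c: "x - c *\<^sub>R p \<in> span ?U"
      by (auto simp: span_insert)
    then have "g (x - c *\<^sub>R p) = 0"
      using linear_eq_0_on_span[OF g(1) gU] by blast
    then have "c = g x" using gp by (simp add: linear_diff[OF g(1)] linear_scale[OF g(1)])
    then show ?thesis
      using span_differences_convex[OF conv ne c] by (simp add: diff_eq_eq add.commute)
  qed
  \<comment> \<open>For \<open>g x > 1\<close> the equation
    \<open>x + t *\<^sub>R b = g x *\<^sub>R p + t *\<^sub>R a\<close> is divided by
    \<open>g x + t\<close>. The right side then lies in \<open>F\<close>; on the left the weights
    sum to less than 1, and the missing weight goes to the origin.\<close>
  have g_le: "g x \<le> 1" if x: "x \<in> ?P" for x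
  proof (rule ccontr)
    assume "\<not> g x \<le> 1"
    then have c: "g x > 1" by simp
    obtain t a b where t: "t \<ge> 0" "a \<in> F" "b \<in> F" "x = g x *\<^sub>R p + t *\<^sub>R (a - b)"
      using decomp[OF x] by blast
    let ?c = "g x"
    let ?y = "(1 / (1 + t)) *\<^sub>R x + (t / (1 + t)) *\<^sub>R b"
    have y: "?y \<in> ?P"
      using t sub x by (intro convexD[OF convex_convex_hull]) (auto simp: field_simps)
    have F: "(?c / (?c + t)) *\<^sub>R p + (t / (?c + t)) *\<^sub>R a \<in> F"
      using t p c by (intro convexD[OF conv]) (auto simp flip: add_divide_distrib)
    have "((1 + t) / (?c + t)) *\<^sub>R ?y = (1 / (?c + t)) *\<^sub>R x + (t / (?c + t)) *\<^sub>R b"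
      using t(1) by (simp add: scaleR_add_right)
    also have "\<dots> = (1 / (?c + t)) *\<^sub>R (?c *\<^sub>R p + t *\<^sub>R (a - b)) + (t / (?c + t)) *\<^sub>R b"
      using t(4) by simp
    also have "\<dots> = (?c / (?c + t)) *\<^sub>R p + (t / (?c + t)) *\<^sub>R a"
      by (simp add: scaleR_add_right scaleR_diff_right)
    finally have "((?c - 1) / (?c + t)) *\<^sub>R 0 + ((1 + t) / (?c + t)) *\<^sub>R ?y \<in> F"
      using F by simp
    then have "0 \<in> F"
      using faceD[of 0 ?y "(?c - 1) / (?c + t)" "(1 + t) / (?c + t)"] zero_P y t(1) c
      by (auto simp flip: add_divide_distrib)
    then show False using zero_F by blast
  qed
  have F_eq: "F = {x \<in> ?P. g x = 1}"
  proof
    show "F \<subseteq> {x \<in> ?P. g x = 1}"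
    proof
      fix x assume x: "x \<in> F"
      then have "g (x - p) = 0" using p by (intro gU) blast
      then show "x \<in> {x \<in> ?P. g x = 1}" using x sub gp by (auto simp: linear_diff[OF g(1)])
    qed
    show "{x \<in> ?P. g x = 1} \<subseteq> F"
    proof
      \<comment> \<open>Here \<open>x + t *\<^sub>R b = p + t *\<^sub>R a\<close>, so a point of
        \<open>F\<close> is a convex combination in which \<open>x\<close> has positive
        weight.\<close>
      fix x assume x: "x \<in> {x \<in> ?P. g x = 1}"
      then obtain t a b where t: "t \<ge> 0" "a \<in> F" "b \<in> F" "x = p + t *\<^sub>R (a - b)"
        using decomp[of x] by auto
      have "(1 / (1 + t)) *\<^sub>R x + (t / (1 + t)) *\<^sub>R b = (1 / (1 + t)) *\<^sub>R p + (t / (1 + t)) *\<^sub>R a"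
        using t(4) by (simp add: scaleR_add_right scaleR_diff_right)
      moreover have "(1 / (1 + t)) *\<^sub>R p + (t / (1 + t)) *\<^sub>R a \<in> F"
        using t p by (intro convexD[OF conv]) (auto simp: field_simps)
      ultimately have "(1 / (1 + t)) *\<^sub>R x + (t / (1 + t)) *\<^sub>R b \<in> F" by metis
      then show "x \<in> F"
        using faceD[of x b "1 / (1 + t)" "t / (1 + t)"] x sub t(1,3)
        by (auto simp flip: add_divide_distrib)
    qed
  qed
  have gX: "\<forall>x\<in>X. g x \<le> 1" using g_le by (auto intro: hull_inc)
  have "span {x \<in> X. g x = 1} = span X"
  proof
    show "span {x \<in> X. g x = 1} \<subseteq> span X" by (rule span_mono) auto
    have "F \<subseteq> span {x \<in> X. g x = 1}"
      using convex_hull_level_subset_span[OF g(1) gX] F_eq by blast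
    then have "insert p ?U \<subseteq> span {x \<in> X. g x = 1}"
      using p by (auto intro!: span_diff)
    then show "span X \<subseteq> span {x \<in> X. g x = 1}"
      unfolding span_U[symmetric] by (intro span_minimal subspace_span)
  qed
  then show ?thesis using that[OF g(1) gX F_eq] by blast
qed

text \<open>A facet is recovered from its trace on \<open>X\<close>: the trace spans, so it fixes
  the functional on \<open>span X\<close>. The nonzero element excludes \<open>X = {0}\<close>,
  where the hull has no facet but \<open>facet_sets X\<close> is \<open>{{}}\<close>.\<close>

lemma num_facets_eq_card_facet_sets:
  fixes X :: "'a::real_vector set"
  assumes X: "finite X" "\<forall>x\<in>X. - x \<in> X" "\<exists>x\<in>X. x \<noteq> 0"
  shows "num_facets (convex hull X) = card (facet_sets X)"
proof -
  have trace: "{x \<in> convex hull X. g x = 1} \<inter> X = {x \<in> X. g x = 1}" for g :: "'a \<Rightarrow> real"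
    by (auto intro: hull_inc)
  have "bij_betw (\<lambda>F. F \<inter> X) {F. is_facet F (convex hull X)} (facet_sets X)"
    unfolding bij_betw_def
  proof
    show "inj_on (\<lambda>F. F \<inter> X) {F. is_facet F (convex hull X)}"
    proof (rule inj_onI)
      fix F F' assume FF': "F \<in> {F. is_facet F (convex hull X)}" "F' \<in> {F. is_facet F (convex hull X)}"
        and eq: "F \<inter> X = F' \<inter> X"
      obtain g :: "'a \<Rightarrow> real" where g: "linear g" "F = {x \<in> convex hull X. g x = 1}"
        "span {x \<in> X. g x = 1} = span X"
        using facet_supporting_functional[OF X(1,2)] FF' by blast
      obtain g' :: "'a \<Rightarrow> real" where g': "linear g'" "F' = {x \<in> convex hull X. g' x = 1}"
        using facet_supporting_functional[OF X(1,2)] FF' by blast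
      have "{x \<in> X. g x = 1} = {x \<in> X. g' x = 1}"
        using eq unfolding g(2) g'(2) trace .
      then have "g x = g' x" if "x \<in> span X" for x
        using linear_eq_on_span[OF g(1) g'(1), of "{x \<in> X. g x = 1}" x] that unfolding g(3) by auto
      moreover have "convex hull X \<subseteq> span X"
        using span_convex_hull[of X] span_superset by blast
      ultimately show "F = F'" unfolding g(2) g'(2) by auto
    qed
    show "(\<lambda>F. F \<inter> X) ` {F. is_facet F (convex hull X)} = facet_sets X"
    proof (intro set_eqI iffI)
      fix S assume "S \<in> (\<lambda>F. F \<inter> X) ` {F. is_facet F (convex hull X)}"
      then obtain F where F: "is_facet F (convex hull X)" "S = F \<inter> X" by blast
      obtain g :: "'a \<Rightarrow> real" where g: "linear g" "\<forall>x\<in>X. g x \<le> 1"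
        "F = {x \<in> convex hull X. g x = 1}" "span {x \<in> X. g x = 1} = span X"
        using facet_supporting_functional[OF X(1,2) F(1)] by blast
      then show "S \<in> facet_sets X"
        unfolding facet_sets_def F(2) g(3) trace by blast
    next
      fix S assume "S \<in> facet_sets X"
      then obtain g :: "'a \<Rightarrow> real" where g: "linear g" "\<forall>x\<in>X. g x \<le> 1"
        "S = {x \<in> X. g x = 1}" "span {x \<in> X. g x = 1} = span X"
        unfolding facet_sets_def by blast
      then show "S \<in> (\<lambda>F. F \<inter> X) ` {F. is_facet F (convex hull X)}"
        using level_set_is_facet[OF X g(1,2,4)] trace[of g] by (intro image_eqI[of _ _ "{x \<in> convex hull X. g x = 1}"]) auto
    qed
  qed
  then show ?thesis
    unfolding num_facets_def by (rule bij_betw_same_card)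
qed

section \<open>Direct sums and odd circuits\<close>

text \<open>A vanishing combination splits into a vector of \<open>span A\<close> and its negative
  in \<open>span B\<close>, so each part vanishes separately.\<close>

lemma independent_Un_if_span_disjoint:
  fixes A B :: "'a::real_vector set"
  assumes "independent A" "independent B" and int: "span A \<inter> span B = {0}"
  shows "independent (A \<union> B)"
  unfolding independent_explicit_module
proof (intro allI impI)
  fix T u v assume T: "finite T" "T \<subseteq> A \<union> B" "(\<Sum>w\<in>T. u w *\<^sub>R w) = 0" "v \<in> T"
  let ?a = "\<Sum>w\<in>T \<inter> A. u w *\<^sub>R w" and ?b = "\<Sum>w\<in>T - A. u w *\<^sub>R w"
  have sum: "?a + ?b = 0"
    using T(1,3) sum.Int_Diff[of T "\<lambda>w. u w *\<^sub>R w" A] by simp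
  have a: "?a \<in> span A" and b: "?b \<in> span B"
    using T(2) by (auto intro!: span_sum span_scale intro: span_base)
  have "?a = - ?b" using sum by (simp add: eq_neg_iff_add_eq_0)
  then have "?a \<in> span A \<inter> span B" using a span_neg[OF b] by simp
  then have zero: "?a = 0" "?b = 0" using int sum by auto
  show "u v = 0"
  proof (cases "v \<in> A")
    case True
    then show ?thesis
      using independentD[OF assms(1) _ _ zero(1), of v] T by auto
  next
    case False
    then show ?thesis
      using independentD[OF assms(2) _ _ zero(2), of v] T by auto
  qed
qed

text \<open>Bases of the two sets form one independent set, on which values can be prescribed
  freely.\<close>

lemma linear_extension_direct_sum:
  fixes g1 g2 :: "'a::real_vector \<Rightarrow> 'b::real_vector"
  assumes "span A \<inter> span B = {0}" "linear g1" "linear g2"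
  obtains g where "linear g" "\<And>x. x \<in> A \<Longrightarrow> g x = g1 x" "\<And>x. x \<in> B \<Longrightarrow> g x = g2 x"
proof -
  obtain A' where A': "A' \<subseteq> A" "independent A'" "A \<subseteq> span A'"
    using maximal_independent_subset by blast
  obtain B' where B': "B' \<subseteq> B" "independent B'" "B \<subseteq> span B'"
    using maximal_independent_subset by blast
  have int: "span A' \<inter> span B' = {0}"
    using assms(1) span_mono[OF A'(1)] span_mono[OF B'(1)] span_zero[of A'] span_zero[of B'] by blast
  have "independent (A' \<union> B')"
    using independent_Un_if_span_disjoint[OF A'(2) B'(2) int] .
  then obtain g where g: "linear g" "\<forall>x\<in>A' \<union> B'. g x = (if x \<in> A' then g1 x else g2 x)"
    using linear_independent_extend[of "A' \<union> B'" "\<lambda>x. if x \<in> A' then g1 x else g2 x"] by blast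
  \<comment> \<open>The two bases could share only 0, which no independent set contains, so the case
    distinction on \<open>A'\<close> is unambiguous.\<close>
  have disj: "x \<notin> A'" if "x \<in> B'" for x
  proof
    assume "x \<in> A'"
    then have "x = 0" using that int span_base by blast
    then show False using \<open>x \<in> A'\<close> A'(2) dependent_zero by blast
  qed
  have "g x = g1 x" if "x \<in> A'" for x using g(2) that by simp
  moreover have "g x = g2 x" if "x \<in> B'" for x using g(2) that disj by simp
  ultimately show ?thesis
    using that[OF g(1)] linear_eq_on_span[OF g(1) assms(2), of A']
      linear_eq_on_span[OF g(1) assms(3), of B'] A'(3) B'(3) by blast
qed

text \<open>Components in a direct sum are unique: writing \<open>a\<close> in \<open>span A\<close>
  as \<open>s + t\<close>, the remainder \<open>a - s\<close> lies in both spans and is 0.\<close>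

lemma span_direct_summand:
  fixes A B :: "'a::real_vector set"
  assumes int: "span A \<inter> span B = {0}" and S: "S \<subseteq> A" "T \<subseteq> B" and span: "span (S \<union> T) = span (A \<union> B)"
  shows "span S = span A"
proof
  show "span S \<subseteq> span A" by (rule span_mono[OF S(1)])
  show "span A \<subseteq> span S"
  proof
    fix a assume a: "a \<in> span A"
    then have "a \<in> span (S \<union> T)" using span span_mono[of A "A \<union> B"] by blast
    then obtain s t where st: "s \<in> span S" "t \<in> span T" "a = s + t"
      unfolding span_Un by blast
    then have "a - s \<in> span A" "a - s \<in> span B"
      using span_diff[OF a, of s] span_mono[OF S(1)] span_mono[OF S(2)] by auto
    then have "a - s = 0" using int by blast
    then show "a \<in> span S" using st(1) by simp
  qed
qed

text \<open>Functionals on the parts glue and restrict, which makes \<open>S \<union> T\<close> a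
  bijection from pairs. The pair is recovered by intersecting with \<open>A\<close> and
  \<open>B\<close>, since their only possible common vector 0 is never at level 1.\<close>

lemma card_facet_sets_direct_sum:
  fixes A B :: "'a::real_vector set"
  assumes int: "span A \<inter> span B = {0}"
  shows "card (facet_sets (A \<union> B)) = card (facet_sets A) * card (facet_sets B)"
proof -
  have zero: "0 \<notin> S" if "S \<in> facet_sets X" for S X :: "'a set"
    using that unfolding facet_sets_def by (auto simp: linear_0)
  have AB: "x = 0" if "x \<in> A" "x \<in> B" for x
    using that int span_base by blast
  have "bij_betw (\<lambda>(S, T). S \<union> T) (facet_sets A \<times> facet_sets B) (facet_sets (A \<union> B))"
    unfolding bij_betw_def
  proof
    have rec: "(S \<union> T) \<inter> A = S" "(S \<union> T) \<inter> B = T" if "S \<in> facet_sets A" "T \<in> facet_sets B" for S T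
    proof -
      have "S \<subseteq> A" "T \<subseteq> B" using that unfolding facet_sets_def by auto
      then show "(S \<union> T) \<inter> A = S" "(S \<union> T) \<inter> B = T"
        using AB zero[OF that(1)] zero[OF that(2)] by blast+
    qed
    show "inj_on (\<lambda>(S, T). S \<union> T) (facet_sets A \<times> facet_sets B)"
    proof (rule inj_onI, clarsimp)
      fix S T S' T' assume "S \<in> facet_sets A" "T \<in> facet_sets B" "S' \<in> facet_sets A"
        "T' \<in> facet_sets B" "S \<union> T = S' \<union> T'"
      then show "S = S' \<and> T = T'" using rec by metis
    qed
    show "(\<lambda>(S, T). S \<union> T) ` (facet_sets A \<times> facet_sets B) = facet_sets (A \<union> B)"
    proof (intro set_eqI iffI)
      fix S assume "S \<in> (\<lambda>(S, T). S \<union> T) ` (facet_sets A \<times> facet_sets B)"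
      then obtain S1 S2 where S: "S = S1 \<union> S2" "S1 \<in> facet_sets A" "S2 \<in> facet_sets B"
        by auto
      obtain g1 :: "'a \<Rightarrow> real" where g1: "linear g1" "\<forall>x\<in>A. g1 x \<le> 1"
        "S1 = {x \<in> A. g1 x = 1}" "span {x \<in> A. g1 x = 1} = span A"
        using S(2) unfolding facet_sets_def by blast
      obtain g2 :: "'a \<Rightarrow> real" where g2: "linear g2" "\<forall>x\<in>B. g2 x \<le> 1"
        "S2 = {x \<in> B. g2 x = 1}" "span {x \<in> B. g2 x = 1} = span B"
        using S(3) unfolding facet_sets_def by blast
      obtain g where g: "linear g" "\<And>x. x \<in> A \<Longrightarrow> g x = g1 x" "\<And>x. x \<in> B \<Longrightarrow> g x = g2 x"
        using linear_extension_direct_sum[OF int g1(1) g2(1)] by blast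
      have S_eq: "S = {x \<in> A \<union> B. g x = 1}"
        unfolding S(1) g1(3) g2(3) using g by auto
      have "span S = span (A \<union> B)"
        unfolding S(1) span_Un g1(3) g1(4) g2(3) g2(4) ..
      then show "S \<in> facet_sets (A \<union> B)"
        unfolding facet_sets_def S_eq using g g1(2) g2(2) by auto
    next
      fix S assume "S \<in> facet_sets (A \<union> B)"
      then obtain g :: "'a \<Rightarrow> real" where g: "linear g" "\<forall>x\<in>A \<union> B. g x \<le> 1"
        "S = {x \<in> A \<union> B. g x = 1}" "span {x \<in> A \<union> B. g x = 1} = span (A \<union> B)"
        unfolding facet_sets_def by blast
      let ?S = "{x \<in> A. g x = 1}" and ?T = "{x \<in> B. g x = 1}"
      have S: "S = ?S \<union> ?T" unfolding g(3) by auto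
      have sp: "span (?S \<union> ?T) = span (A \<union> B)" using g(3,4) S by simp
      have "span ?S = span A" using sp int by (intro span_direct_summand[of A B ?S ?T]) auto
      moreover have "span ?T = span B"
        using sp int by (intro span_direct_summand[of B A ?T ?S]) (auto simp: Un_commute Int_commute)
      ultimately have "?S \<in> facet_sets A" "?T \<in> facet_sets B"
        unfolding facet_sets_def using g(1,2) by blast+
      then show "S \<in> (\<lambda>(S, T). S \<union> T) ` (facet_sets A \<times> facet_sets B)"
        using S by auto
    qed
  qed
  then show ?thesis
    by (metis bij_betw_same_card card_cartesian_product)
qed

text \<open>The hypotheses say that, up to scaling, \<open>(\<Sum>i<2 * l + 1. x i) = 0\<close> is the only linear
  relation between the vectors.
  A functional with values in \<open>[-1, 1]\<close> then corresponds to a facet iff at most one value differs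
  from \<open>\<plusminus>1\<close>; as the values sum to zero and their number is odd, parity forces exactly one value
  \<open>0\<close> and equally many values \<open>1\<close> and \<open>-1\<close>.\<close>

lemma card_facet_sets_odd_circuit:
  fixes x :: "nat \<Rightarrow> 'a::real_vector"
  assumes sum0: "(\<Sum>i<2 * l + 1. x i) = 0"
    and ext: "\<And>\<alpha> :: nat \<Rightarrow> real. (\<Sum>i<2 * l + 1. \<alpha> i) = 0 \<Longrightarrow> \<exists>g. linear g \<and> (\<forall>i<2 * l + 1. g (x i) = \<alpha> i)"
  shows "card (facet_sets (x ` {..<2 * l + 1} \<union> (\<lambda>i. - x i) ` {..<2 * l + 1})) = (2 * l + 1) * ((2 * l) choose l)"
proof -
  define I where "I = {..<2 * l + 1}"
  define X where "X = x ` I \<union> (\<lambda>i. - x i) ` I"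
  \<comment> \<open>\<open>j\<close> is the index of value 0 and \<open>P\<close> the set of indices
    of value 1; the other \<open>l\<close> indices get -1. \<open>\<Phi>\<close> lists the signed
    vectors at level 1.\<close>
  define D where "D = (SIGMA j:I. {P. P \<subseteq> I - {j} \<and> card P = l})"
  define \<Phi> where "\<Phi> = (\<lambda>(j, P). x ` P \<union> (\<lambda>i. - x i) ` (I - {j} - P))"
  have I: "finite I" "card I = 2 * l + 1" unfolding I_def by auto
  have functional: "\<exists>g :: 'a \<Rightarrow> real. linear g \<and> g (x j) = 0 \<and> (\<forall>i\<in>P. g (x i) = 1) \<and> (\<forall>i\<in>I - {j} - P. g (x i) = -1)"
    if jP: "(j, P) \<in> D" for j P
  proof -
    have j: "j \<in> I" and P: "P \<subseteq> I - {j}" "card P = l" using jP unfolding D_def by auto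
    \<comment> \<open>Both \<open>P\<close> and its complement in \<open>I - {j}\<close> have
      \<open>l\<close> elements, so the values sum to 0 and \<open>ext\<close> applies.\<close>
    let ?\<alpha> = "\<lambda>i. if i = j then 0 else if i \<in> P then 1 else - 1 :: real"
    have "(\<Sum>i\<in>I. ?\<alpha> i) = (\<Sum>i\<in>I - {j}. ?\<alpha> i)"
      using j I(1) by (simp add: sum.remove)
    also have "\<dots> = (\<Sum>i\<in>I - {j} - P. ?\<alpha> i) + (\<Sum>i\<in>P. ?\<alpha> i)"
      using P(1) I(1) by (intro sum.subset_diff) auto
    also have "(\<Sum>i\<in>I - {j} - P. ?\<alpha> i) = (\<Sum>i\<in>I - {j} - P. - 1)"
      by (intro sum.cong) auto
    also have "(\<Sum>i\<in>P. ?\<alpha> i) = (\<Sum>i\<in>P. 1)"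
      using P(1) by (intro sum.cong) auto
    also have "(\<Sum>i\<in>I - {j} - P. - 1) + (\<Sum>i\<in>P. 1) = (0::real)"
      using P j I finite_subset[OF P(1)] by (simp add: card_Diff_subset)
    finally have "(\<Sum>i<2 * l + 1. ?\<alpha> i) = 0" unfolding I_def .
    then obtain g :: "'a \<Rightarrow> real" where g: "linear g" "\<forall>i\<in>I. g (x i) = ?\<alpha> i"
      using ext[of ?\<alpha>] unfolding I_def by auto
    have "i \<in> I \<and> i \<noteq> j" if "i \<in> P" for i using that P(1) by blast
    then show ?thesis using g j by (intro exI[of _ g]) auto
  qed
  have \<Phi>_mem: "\<Phi> (j, P) = {v \<in> X. g v = 1}"
    if D: "(j, P) \<in> D" and g: "linear g" "g (x j) = 0" "\<forall>i\<in>P. g (x i) = 1" "\<forall>i\<in>I - {j} - P. g (x i) = -1"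
    for j P and g :: "'a \<Rightarrow> real"
  proof -
    have P: "P \<subseteq> I - {j}" using D unfolding D_def by auto
    have pos: "i \<in> P" if "i \<in> I" "g (x i) = 1" for i using that g by force
    have neg: "i \<in> I - {j} - P" if "i \<in> I" "g (x i) = -1" for i using that g by force
    show ?thesis
    proof (intro set_eqI iffI)
      fix v assume "v \<in> \<Phi> (j, P)"
      then consider i where "i \<in> P" "v = x i" | i where "i \<in> I - {j} - P" "v = - x i"
        unfolding \<Phi>_def by auto
      then show "v \<in> {v \<in> X. g v = 1}"
        using P g(3,4) linear_neg[OF g(1)] unfolding X_def by cases auto
    next
      fix v assume "v \<in> {v \<in> X. g v = 1}"
      then consider i where "i \<in> I" "g (x i) = 1" "v = x i" | i where "i \<in> I" "g (- x i) = 1" "v = - x i"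
        unfolding X_def by blast
      then show "v \<in> \<Phi> (j, P)"
      proof cases
        case 1
        then show ?thesis using pos unfolding \<Phi>_def by simp
      next
        case (2 i)
        then have "g (x i) = -1" using linear_neg[OF g(1), of "x i"] by simp
        then show ?thesis using neg[OF 2(1)] 2(3) unfolding \<Phi>_def by simp
      qed
    qed
  qed
  \<comment> \<open>Membership of \<open>x i\<close> or \<open>- x i\<close> is decided by the value
    of \<open>g\<close> at \<open>x i\<close>, so \<open>\<Phi> (j, P)\<close> determines
    \<open>P\<close> and then \<open>j\<close>. This gives injectivity.\<close>
  have index: "{i \<in> I. x i \<in> \<Phi> (j, P)} = P" "{i \<in> I. - x i \<in> \<Phi> (j, P)} = I - {j} - P"
    if D: "(j, P) \<in> D" for j P
  proof -
    have P: "P \<subseteq> I - {j}" "j \<in> I" using D unfolding D_def by auto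
    obtain g :: "'a \<Rightarrow> real" where g: "linear g" "g (x j) = 0" "\<forall>i\<in>P. g (x i) = 1" "\<forall>i\<in>I - {j} - P. g (x i) = -1"
      using functional[OF D] by blast
    have "x i \<in> X" "- x i \<in> X" if "i \<in> I" for i using that unfolding X_def by auto
    then have "{i \<in> I. x i \<in> \<Phi> (j, P)} = {i \<in> I. g (x i) = 1}"
      "{i \<in> I. - x i \<in> \<Phi> (j, P)} = {i \<in> I. g (x i) = -1}"
      unfolding \<Phi>_mem[OF D g] by (auto simp: linear_neg[OF g(1)])
    moreover have "{i \<in> I. g (x i) = 1} = P" "{i \<in> I. g (x i) = -1} = I - {j} - P"
      using P g by force+
    ultimately show "{i \<in> I. x i \<in> \<Phi> (j, P)} = P" "{i \<in> I. - x i \<in> \<Phi> (j, P)} = I - {j} - P"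
      by simp_all
  qed
  have "bij_betw \<Phi> D (facet_sets X)"
    unfolding bij_betw_def
  proof
    show "inj_on \<Phi> D"
    proof (rule inj_onI, clarify)
      fix j P k Q assume D: "(j, P) \<in> D" "(k, Q) \<in> D" "\<Phi> (j, P) = \<Phi> (k, Q)"
      have "P = Q" using index(1)[OF D(1)] index(1)[OF D(2)] D(3) by simp
      moreover have "I - {j} - P = I - {k} - Q"
        using index(2)[OF D(1)] index(2)[OF D(2)] D(3) by simp
      moreover have "j \<in> I" "k \<in> I" "j \<notin> P" "k \<notin> Q" using D(1,2) unfolding D_def by auto
      ultimately show "j = k \<and> P = Q" by blast
    qed
    show "\<Phi> ` D = facet_sets X"
    proof (intro set_eqI iffI)
      fix S assume "S \<in> \<Phi> ` D"
      then obtain j P where D: "(j, P) \<in> D" and S: "S = \<Phi> (j, P)" by auto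
      have P: "P \<subseteq> I - {j}" "j \<in> I" using D unfolding D_def by auto
      obtain g :: "'a \<Rightarrow> real" where g: "linear g" "g (x j) = 0" "\<forall>i\<in>P. g (x i) = 1" "\<forall>i\<in>I - {j} - P. g (x i) = -1"
        using functional[OF D] by blast
      have S_eq: "S = {v \<in> X. g v = 1}" using \<Phi>_mem[OF D g] S by simp
      have "\<bar>g (x i)\<bar> \<le> 1" if "i \<in> I" for i using that g by (cases "i = j"; cases "i \<in> P") auto
      then have le: "\<forall>v\<in>X. g v \<le> 1" unfolding X_def by (fastforce simp: linear_neg[OF g(1)])
      have span_other: "x i \<in> span S" if "i \<in> I - {j}" for i
      proof (cases "i \<in> P")
        case True
        then show ?thesis unfolding S \<Phi>_def by (auto intro: span_base)
      next
        case False
        then have "- x i \<in> span S" using that unfolding S \<Phi>_def by (auto intro: span_base)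
        then show ?thesis using span_neg[of "- x i" S] by simp
      qed
      \<comment> \<open>The linear relation supplies the one vector that neither sign puts into
        \<open>S\<close>.\<close>
      have "x j + (\<Sum>i\<in>I - {j}. x i) = 0"
        using sum0 P(2) I(1) unfolding I_def[symmetric] by (simp add: sum.remove[symmetric])
      then have x_j: "x j = - (\<Sum>i\<in>I - {j}. x i)" by (simp add: eq_neg_iff_add_eq_0)
      have "x j \<in> span S"
        unfolding x_j by (intro span_neg span_sum span_other)
      then have "x i \<in> span S" if "i \<in> I" for i using span_other that by (cases "i = j") auto
      then have "X \<subseteq> span S" unfolding X_def by (auto intro: span_neg)
      moreover have "S \<subseteq> X" unfolding S_eq by auto
      ultimately have "span S = span X"
        by (meson span_minimal span_mono subspace_span subset_antisym)
      then show "S \<in> facet_sets X"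
        unfolding facet_sets_def S_eq using g(1) le by blast
    next
      fix S assume "S \<in> facet_sets X"
      then obtain g :: "'a \<Rightarrow> real" where g: "linear g" "\<forall>v\<in>X. g v \<le> 1" "S = {v \<in> X. g v = 1}"
        "span {v \<in> X. g v = 1} = span X"
        unfolding facet_sets_def by blast
      define \<alpha> where "\<alpha> i = g (x i)" for i
      have \<alpha>_bound: "- 1 \<le> \<alpha> i" "\<alpha> i \<le> 1" if "i \<in> I" for i
        using g(2) that linear_neg[OF g(1), of "x i"] unfolding X_def \<alpha>_def by force+
      have \<alpha>_sum: "(\<Sum>i\<in>I. \<alpha> i) = 0"
        using sum0 linear_sum[OF g(1), of x I] linear_0[OF g(1)] unfolding \<alpha>_def I_def by simp
      define P where "P = {i \<in> I. \<alpha> i = 1}"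
      define N where "N = {i \<in> I. \<alpha> i = -1}"
      define Z where "Z = I - P - N"
      have S_PN: "S = x ` P \<union> (\<lambda>i. - x i) ` N"
        unfolding g(3) X_def P_def N_def \<alpha>_def by (auto simp: linear_neg[OF g(1)] minus_equation_iff[of 1])
      \<comment> \<open>With two free indices, a functional that is 1 and -1 there and 0 at all
        other indices would vanish on the spanning set \<open>S\<close> but not on
        \<open>x i\<close>.\<close>
      have unique: "i = j" if ij: "i \<in> Z" "j \<in> Z" for i j
      proof (rule ccontr)
        assume "i \<noteq> j"
        let ?\<beta> = "\<lambda>k. if k = i then 1 else if k = j then - 1 else 0 :: real"
        have mem: "i \<in> I" "j \<in> I" using ij unfolding Z_def by auto
        have "(\<Sum>k\<in>I. ?\<beta> k) = (\<Sum>k\<in>{i, j}. ?\<beta> k)"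
          using mem I(1) by (intro sum.mono_neutral_right) auto
        also have "\<dots> = 0" using \<open>i \<noteq> j\<close> by simp
        finally obtain h :: "'a \<Rightarrow> real" where h: "linear h" "\<forall>k\<in>I. h (x k) = ?\<beta> k"
          using ext[of ?\<beta>] unfolding I_def by auto
        have "h v = 0" if "v \<in> S" for v
          using that h(2) ij unfolding S_PN Z_def P_def N_def by (auto simp: linear_neg[OF h(1)])
        then have "h v = 0" if "v \<in> span X" for v
          using linear_eq_0_on_span[OF h(1)] that g(3,4) by metis
        moreover have "x i \<in> span X" using mem unfolding X_def by (auto intro: span_base)
        ultimately show False using h(2) mem by force
      qed
      have disj: "P \<inter> N = {}" unfolding P_def N_def by auto
      have sub: "P \<subseteq> I" "N \<subseteq> I" "Z \<subseteq> I" unfolding P_def N_def Z_def by auto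
      have fin: "finite P" "finite N" "finite Z" using sub by (simp_all add: finite_subset[OF _ I(1)])
      have I_eq: "P \<union> N \<union> Z = I" and disj_Z: "(P \<union> N) \<inter> Z = {}"
        unfolding Z_def using sub by auto
      have "sum \<alpha> (P \<union> N \<union> Z) = sum \<alpha> P + sum \<alpha> N + sum \<alpha> Z"
        "card (P \<union> N \<union> Z) = card P + card N + card Z"
        using fin disj disj_Z by (simp_all add: sum.union_disjoint card_Un_disjoint)
      then have "(\<Sum>i\<in>I. \<alpha> i) = (\<Sum>i\<in>P. \<alpha> i) + (\<Sum>i\<in>N. \<alpha> i) + (\<Sum>i\<in>Z. \<alpha> i)"
        and card: "card I = card P + card N + card Z"
        unfolding I_eq by simp_all
      moreover have "(\<Sum>i\<in>P. \<alpha> i) = real (card P)" "(\<Sum>i\<in>N. \<alpha> i) = - real (card N)"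
        unfolding P_def N_def by simp_all
      ultimately have bal: "real (card P) - real (card N) + (\<Sum>i\<in>Z. \<alpha> i) = 0"
        using \<alpha>_sum by simp
      \<comment> \<open>If all values were 1 or -1, a zero sum would force an even number of
        them.\<close>
      have "Z \<noteq> {}"
      proof
        assume "Z = {}"
        then have "card P = card N" "card P + card N = 2 * l + 1" using bal card I(2) by auto
        then show False by presburger
      qed
      then obtain j where j: "j \<in> Z" by blast
      have Z: "Z = {j}" using j unique by blast
      \<comment> \<open>The value at \<open>j\<close> balances an integer and has absolute value
        below 1, so that integer is 0.\<close>
      have "\<bar>\<alpha> j\<bar> < 1"
        using j \<alpha>_bound[of j] sub(3) unfolding Z_def P_def N_def by force
      then have "\<bar>real (card P) - real (card N)\<bar> < 1" using bal Z by simp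
      then have "card P = card N" by linarith
      moreover have "card P + card N = 2 * l" using card Z I(2) by simp
      ultimately have cP: "card P = l" by simp
      have jI: "j \<in> I" using j sub(3) by blast
      have N: "N = I - {j} - P" using Z disj sub unfolding Z_def by blast
      have "(j, P) \<in> D" unfolding D_def using jI cP sub(1) j Z_def by auto
      moreover have "S = \<Phi> (j, P)" unfolding \<Phi>_def S_PN N by simp
      ultimately show "S \<in> \<Phi> ` D" by blast
    qed
  qed
  then have "card (facet_sets X) = card D" by (simp add: bij_betw_same_card)
  also have "\<dots> = (\<Sum>j\<in>I. card {P. P \<subseteq> I - {j} \<and> card P = l})"
    unfolding D_def using I(1) by (intro card_SigmaI) auto
  also have "\<dots> = (\<Sum>j\<in>I. (2 * l) choose l)"
    using I by (intro sum.cong) (auto simp: n_subsets)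
  also have "\<dots> = (2 * l + 1) * ((2 * l) choose l)" using I by simp
  finally show ?thesis unfolding X_def I_def .
qed

text \<open>The hull is a segment whose facets are its two endpoints; \<open>h\<close> and its
  negative cut them out.\<close>

lemma card_facet_sets_pair:
  fixes z :: "'a::real_vector"
  assumes "z \<noteq> 0"
  shows "card (facet_sets {z, - z}) = 2"
proof -
  have neq: "z \<noteq> - z" using assms by (simp add: eq_neg_iff_add_eq_0 flip: scaleR_2)
  have "independent {z}" using assms by simp
  then obtain h :: "'a \<Rightarrow> real" where h: "linear h" "h z = 1"
    using linear_independent_extend[of "{z}" "\<lambda>_. 1"] by auto
  have "- z \<in> span {z}" "z \<in> span {- z}"
    using span_neg[of z "{z}"] span_neg[of "- z" "{- z}"] by (simp_all add: span_base)
  then have span: "span {z} = span {z, - z}" "span {- z} = span {z, - z}"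
    unfolding span_eq by (simp_all add: span_base)
  have "facet_sets {z, - z} = {{z}, {- z}}"
  proof (intro set_eqI iffI)
    fix S assume "S \<in> facet_sets {z, - z}"
    then obtain g :: "'a \<Rightarrow> real" where g: "linear g" "S = {x \<in> {z, - z}. g x = 1}"
      "span {x \<in> {z, - z}. g x = 1} = span {z, - z}"
      unfolding facet_sets_def by blast
    have "S \<noteq> {}"
    proof
      assume "S = {}"
      then have "span {z, - z} = {0}" using g(2,3) by (metis span_empty)
      then show False using assms span_base[of z "{z, - z}"] by auto
    qed
    then show "S \<in> {{z}, {- z}}"
      unfolding g(2) using linear_neg[OF g(1), of z] by auto
  next
    fix S assume "S \<in> {{z}, {- z}}"
    moreover have "{x \<in> {z, - z}. h x = 1} = {z}" "{x \<in> {z, - z}. - h x = 1} = {- z}"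
      using h linear_neg[OF h(1), of z] by auto
    moreover have "linear (\<lambda>x. - h x)" using h(1) by (rule linear_compose_neg)
    ultimately show "S \<in> facet_sets {z, - z}"
      unfolding facet_sets_def using h linear_neg[OF h(1), of z] span
      by (auto intro: exI[of _ h] exI[of _ "\<lambda>x. - h x"])
  qed
  then show ?thesis using neq by auto
qed

section \<open>Symmetric edge polytopes\<close>

text \<open>Edges are unordered, so each contributes both orientations and the set is
  symmetric.\<close>

definition edge_vectors :: "nat graph \<Rightarrow> (nat \<Rightarrow>\<^sub>0 real) set" where
  "edge_vectors G = {std_basis i - std_basis j | i j. {i, j} \<in> edges G}"

lemma edge_vectors_uminus: "v \<in> edge_vectors G \<Longrightarrow> - v \<in> edge_vectors G"
  unfolding edge_vectors_def by (force simp: insert_commute)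

lemma sym_edge_polytope_eq: "sym_edge_polytope G = convex hull edge_vectors G"
proof -
  have "{- (std_basis i - std_basis j) | i j. {i, j} \<in> edges G} \<subseteq> edge_vectors G"
    using edge_vectors_uminus unfolding edge_vectors_def by blast
  then show ?thesis
    unfolding sym_edge_polytope_def edge_vectors_def[symmetric] by (simp add: Un_absorb2)
qed

definition finite_graph :: "'v graph \<Rightarrow> bool" where
  "finite_graph G \<longleftrightarrow> finite (verts G) \<and> \<Union>(edges G) \<subseteq> verts G"

lemma edge_vectorsE:
  assumes "finite_graph G" "w \<in> edge_vectors G"
  obtains i j where "i \<in> verts G" "j \<in> verts G" "w = std_basis i - std_basis j"
proof -
  obtain i j where ij: "{i, j} \<in> edges G" "w = std_basis i - std_basis j"
    using assms(2) unfolding edge_vectors_def by blast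
  have "{i, j} \<subseteq> verts G"
    using ij(1) assms(1) unfolding finite_graph_def by blast
  then show ?thesis using that ij(2) by blast
qed

lemma finite_edge_vectors:
  assumes "finite_graph G"
  shows "finite (edge_vectors G)"
proof (rule finite_subset)
  show "edge_vectors G \<subseteq> (\<lambda>(i, j). std_basis i - std_basis j) ` (verts G \<times> verts G)"
    by (rule subsetI, erule edge_vectorsE[OF assms]) auto
  show "finite ((\<lambda>(i, j). std_basis i - std_basis j) ` (verts G \<times> verts G))"
    using assms unfolding finite_graph_def by simp
qed

lemma finite_graph_iso: "graph_iso G H \<Longrightarrow> finite_graph G \<Longrightarrow> finite_graph H"
proof -
  assume "graph_iso G H" and G: "finite_graph G"
  then obtain f where "verts H = f ` verts G" "edges H = (\<lambda>e. f ` e) ` edges G"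
    unfolding graph_iso_def bij_betw_def by metis
  then show ?thesis using G unfolding finite_graph_def by auto
qed

lemma finite_graph_cycle: "m \<ge> 1 \<Longrightarrow> finite_graph (cycle_graph m)"
  unfolding finite_graph_def cycle_graph_def by auto

lemma finite_graph_single_edge: "finite_graph single_edge"
  unfolding finite_graph_def single_edge_def by auto

lemma finite_graph_wedge: "is_wedge G H W \<Longrightarrow> finite_graph G \<Longrightarrow> finite_graph H \<Longrightarrow> finite_graph W"
proof -
  assume "is_wedge G H W" "finite_graph G" "finite_graph H"
  then obtain A B where "finite_graph A" "finite_graph B" "W = (verts A \<union> verts B, edges A \<union> edges B)"
    unfolding is_wedge_def using finite_graph_iso by metis
  then show ?thesis unfolding finite_graph_def by auto
qed

text \<open>The bound on the cardinality provides a nonzero edge vector: if all were 0, the empty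
  set would be the only candidate in \<open>facet_sets\<close>.\<close>

lemma num_facets_sym_edge_polytope:
  assumes G: "finite_graph G" and card: "card (facet_sets (edge_vectors G)) > 1"
  shows "num_facets (sym_edge_polytope G) = card (facet_sets (edge_vectors G))"
  unfolding sym_edge_polytope_eq
proof (rule num_facets_eq_card_facet_sets)
  show "finite (edge_vectors G)" by (rule finite_edge_vectors[OF G])
  show "\<forall>x\<in>edge_vectors G. - x \<in> edge_vectors G" using edge_vectors_uminus by blast
  show "\<exists>x\<in>edge_vectors G. x \<noteq> 0"
  proof (rule ccontr)
    assume "\<not> (\<exists>x\<in>edge_vectors G. x \<noteq> 0)"
    then have "facet_sets (edge_vectors G) \<subseteq> {{}}"
      unfolding facet_sets_def by (auto simp: linear_0)
    then have "card (facet_sets (edge_vectors G)) \<le> card {{} :: (nat \<Rightarrow>\<^sub>0 real) set}"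
      by (intro card_mono) auto
    then show False using card by simp
  qed
qed

lemma lookup_scaleR: "Poly_Mapping.lookup (r *\<^sub>R v) k = r *\<^sub>R Poly_Mapping.lookup v k"
  for v :: "'a \<Rightarrow>\<^sub>0 'b::real_vector"
proof -
  have "finite {i. r *\<^sub>R Poly_Mapping.lookup v i \<noteq> 0}"
    by (rule finite_subset[OF _ finite_lookup[of v]]) auto
  then show ?thesis unfolding scaleR_poly_mapping_def by simp
qed

text \<open>Vertex weights \<open>\<phi>\<close> act as potentials: for finite \<open>V\<close>
  containing \<open>i\<close> and \<open>j\<close>, the value at
  \<open>std_basis i - std_basis j\<close> is \<open>\<phi> i - \<phi> j\<close>.\<close>

lemma linear_weighted_lookup:
  "linear (\<lambda>v :: 'a \<Rightarrow>\<^sub>0 real. \<Sum>k\<in>V. \<phi> k * Poly_Mapping.lookup v k)"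
  by (rule linearI)
    (simp_all add: lookup_add lookup_scaleR distrib_left sum.distrib sum_distrib_left mult.left_commute)

lemma lookup_std_basis: "Poly_Mapping.lookup (std_basis i) k = (if k = i then 1 else 0)"
  unfolding std_basis_def by (simp add: lookup_single when_def)

lemma weighted_lookup_std_basis:
  assumes "finite V" "i \<in> V"
  shows "(\<Sum>k\<in>V. \<phi> k * Poly_Mapping.lookup (std_basis i) k) = \<phi> i"
  using assms by (simp add: lookup_std_basis if_distrib[of "\<lambda>c. _ * c"] cong: if_cong)

lemma span_edge_vectors:
  assumes G: "finite_graph G" and v: "v \<in> span (edge_vectors G)"
  shows "k \<notin> verts G \<Longrightarrow> Poly_Mapping.lookup v k = 0"
    and "(\<Sum>k\<in>verts G. Poly_Mapping.lookup v k) = 0"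
proof -
  show "Poly_Mapping.lookup v k = 0" if "k \<notin> verts G"
  proof -
    have "linear (\<lambda>v :: nat \<Rightarrow>\<^sub>0 real. Poly_Mapping.lookup v k)"
      using linear_weighted_lookup[of "\<lambda>_. 1" "{k}"] by simp
    moreover have "Poly_Mapping.lookup w k = 0" if "w \<in> edge_vectors G" for w
      using that \<open>k \<notin> verts G\<close> by (auto elim!: edge_vectorsE[OF G] simp: lookup_minus lookup_std_basis)
    ultimately show ?thesis using v by (rule linear_eq_0_on_span)
  qed
  have "linear (\<lambda>v :: nat \<Rightarrow>\<^sub>0 real. \<Sum>k\<in>verts G. Poly_Mapping.lookup v k)"
    using linear_weighted_lookup[of "\<lambda>_. 1" "verts G"] by simp
  moreover have "(\<Sum>k\<in>verts G. Poly_Mapping.lookup w k) = 0" if "w \<in> edge_vectors G" for w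
    using that G[unfolded finite_graph_def]
    by (auto elim!: edge_vectorsE[OF G] simp: lookup_minus sum_subtractf lookup_std_basis)
  ultimately show "(\<Sum>k\<in>verts G. Poly_Mapping.lookup v k) = 0"
    using v by (rule linear_eq_0_on_span)
qed

text \<open>A common vector is supported on the shared vertex alone, and its coordinates sum to
  0.\<close>

lemma span_edge_vectors_wedge:
  assumes A: "finite_graph A" and B: "finite_graph B" and x: "verts A \<inter> verts B = {x}"
  shows "span (edge_vectors A) \<inter> span (edge_vectors B) = {0}"
proof -
  have "v = 0" if v: "v \<in> span (edge_vectors A)" "v \<in> span (edge_vectors B)" for v
  proof -
    have supp: "Poly_Mapping.lookup v k = 0" if "k \<noteq> x" for k
      using that x span_edge_vectors(1)[OF A v(1), of k] span_edge_vectors(1)[OF B v(2), of k] by auto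
    have "(\<Sum>k\<in>verts A. Poly_Mapping.lookup v k) = (\<Sum>k\<in>{x}. Poly_Mapping.lookup v k)"
      using A x supp unfolding finite_graph_def by (intro sum.mono_neutral_right) auto
    then have "Poly_Mapping.lookup v x = 0" using span_edge_vectors(2)[OF A v(1)] by simp
    then show ?thesis using supp by (intro poly_mapping_eqI) (metis lookup_zero)
  qed
  then show ?thesis by (auto simp: span_zero)
qed

text \<open>The counts are assumed for all isomorphic copies because a wedge may use any copies of
  its two graphs.\<close>

lemma card_facet_sets_wedge:
  assumes W: "is_wedge G H W" and fin: "finite_graph G" "finite_graph H"
    and G: "\<And>A. graph_iso G A \<Longrightarrow> card (facet_sets (edge_vectors A)) = p"
    and H: "\<And>B. graph_iso H B \<Longrightarrow> card (facet_sets (edge_vectors B)) = q"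
  shows "card (facet_sets (edge_vectors W)) = p * q"
proof -
  obtain A B x where AB: "graph_iso G A" "graph_iso H B" "verts A \<inter> verts B = {x}"
    "W = (verts A \<union> verts B, edges A \<union> edges B)"
    using W unfolding is_wedge_def by blast
  have "edge_vectors W = edge_vectors A \<union> edge_vectors B"
    unfolding edge_vectors_def AB(4) by auto
  then show ?thesis
    using card_facet_sets_direct_sum[OF span_edge_vectors_wedge[OF _ _ AB(3)]]
      finite_graph_iso[OF AB(1) fin(1)] finite_graph_iso[OF AB(2) fin(2)] G[OF AB(1)] H[OF AB(2)]
    by simp
qed

section \<open>Facet counts for odd cycles and single edges\<close>

text \<open>Cyclic indexing from 0 treats the closing edge \<open>{m, 1}\<close> like the others, as
  the case \<open>i = m - 1\<close>.\<close>

lemma edges_cycle_graph: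
  assumes "m \<ge> 1"
  shows "edges (cycle_graph m) = (\<lambda>i. {Suc i, Suc (Suc i mod m)}) ` {..<m}"
proof (intro set_eqI iffI)
  fix e assume "e \<in> edges (cycle_graph m)"
  then consider i where "1 \<le> i" "i < m" "e = {i, i + 1}" | "e = {m, 1}"
    unfolding cycle_graph_def by auto
  then show "e \<in> (\<lambda>i. {Suc i, Suc (Suc i mod m)}) ` {..<m}"
  proof cases
    case 1
    then show ?thesis by (intro image_eqI[of _ _ "i - 1"]) auto
  next
    case 2
    then show ?thesis using assms by (intro image_eqI[of _ _ "m - 1"]) auto
  qed
next
  fix e assume "e \<in> (\<lambda>i. {Suc i, Suc (Suc i mod m)}) ` {..<m}"
  then obtain i where i: "i < m" "e = {Suc i, Suc (Suc i mod m)}" by auto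
  show "e \<in> edges (cycle_graph m)"
  proof (cases "Suc i = m")
    case True
    then show ?thesis using i(2) unfolding cycle_graph_def by simp
  next
    case False
    then have "Suc i < m" using i(1) by simp
    then show ?thesis using i(2) unfolding cycle_graph_def by auto
  qed
qed

text \<open>Edge vectors taken around the cycle telescope to 0. Conversely, values on the edges with
  zero sum are the differences of a vertex potential, so the count for odd circuits applies.\<close>

lemma card_facet_sets_odd_cycle:
  assumes A: "graph_iso (cycle_graph (2 * l + 1)) A"
  shows "card (facet_sets (edge_vectors A)) = (2 * l + 1) * ((2 * l) choose l)"
proof -
  define m where "m = 2 * l + 1"
  have m: "m \<ge> 1" unfolding m_def by simp
  obtain f where f: "bij_betw f {1..m} (verts A)" "edges A = (\<lambda>e. f ` e) ` edges (cycle_graph m)"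
    using A unfolding graph_iso_def m_def by (auto simp: cycle_graph_def)
  define c where "c i = std_basis (f (Suc (i mod m)))" for i
  define x where "x i = c i - c (Suc i)" for i
  have edges: "edges A = (\<lambda>i. {f (Suc i), f (Suc (Suc i mod m))}) ` {..<m}"
    unfolding f(2) edges_cycle_graph[OF m] image_image by simp
  have "edge_vectors A = x ` {..<m} \<union> (\<lambda>i. - x i) ` {..<m}"
  proof (intro set_eqI iffI)
    fix v assume "v \<in> edge_vectors A"
    then obtain i a b where "i < m" "v = std_basis a - std_basis b" "{a, b} = {f (Suc i), f (Suc (Suc i mod m))}"
      unfolding edge_vectors_def edges by auto
    then have "i < m \<and> (v = x i \<or> v = - x i)"
      unfolding x_def c_def by (auto simp: doubleton_eq_iff)
    then show "v \<in> x ` {..<m} \<union> (\<lambda>i. - x i) ` {..<m}" by auto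
  next
    fix v assume "v \<in> x ` {..<m} \<union> (\<lambda>i. - x i) ` {..<m}"
    then obtain i where i: "i < m" "v = x i \<or> v = - x i" by auto
    then have "x i \<in> edge_vectors A"
      unfolding edge_vectors_def edges x_def c_def by auto
    then show "v \<in> edge_vectors A" using i(2) edge_vectors_uminus by blast
  qed
  moreover have "card (facet_sets (x ` {..<m} \<union> (\<lambda>i. - x i) ` {..<m})) = (2 * l + 1) * ((2 * l) choose l)"
    unfolding m_def
  proof (rule card_facet_sets_odd_circuit, fold m_def)
    show "(\<Sum>i<m. x i) = 0"
      unfolding x_def sum_lessThan_telescope' by (simp add: c_def)
  next
    fix \<alpha> :: "nat \<Rightarrow> real" assume sum0: "(\<Sum>i<m. \<alpha> i) = 0"
    \<comment> \<open>The potential is minus a partial sum, so its drop along edge \<open>i\<close>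
      is \<open>\<alpha> i\<close>. Subtracting 1 turns vertex labels from 1 to \<open>m\<close>
      into indices from 0.\<close>
    define \<phi> where "\<phi> v = - (\<Sum>k < inv_into {1..m} f v - 1. \<alpha> k)" for v
    define g where "g v = (\<Sum>k\<in>verts A. \<phi> k * Poly_Mapping.lookup v k)" for v :: "nat \<Rightarrow>\<^sub>0 real"
    have fin: "finite (verts A)" using f(1) bij_betw_finite by blast
    have lin: "linear g" unfolding g_def by (rule linear_weighted_lookup)
    have g_mod: "g (c i) = - (\<Sum>k<i mod m. \<alpha> k)" for i
    proof -
      have im: "Suc (i mod m) \<in> {1..m}" using m by (simp add: Suc_leI)
      then have "f (Suc (i mod m)) \<in> verts A" using f(1) bij_betwE by blast
      then have "g (c i) = \<phi> (f (Suc (i mod m)))"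
        unfolding g_def c_def using weighted_lookup_std_basis[OF fin] by simp
      also have "\<dots> = - (\<Sum>k<i mod m. \<alpha> k)"
        unfolding \<phi>_def using inv_into_f_f[OF bij_betw_imp_inj_on[OF f(1)] im] by simp
      finally show ?thesis .
    qed
    \<comment> \<open>At \<open>i = m\<close> the reduction returns to index 0 with the empty sum;
      the zero total makes this consistent.\<close>
    have "g (c i) = - (\<Sum>k<i. \<alpha> k)" if "i \<le> m" for i
      using g_mod[of i] that sum0 by (cases "i = m") auto
    then have "g (x i) = \<alpha> i" if "i < m" for i
      using that unfolding x_def by (simp add: linear_diff[OF lin])
    then show "\<exists>g. linear g \<and> (\<forall>i<m. g (x i) = \<alpha> i)" using lin by blast
  qed
  ultimately show ?thesis by simp
qed

lemma card_facet_sets_single_edge: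
  assumes "graph_iso single_edge B"
  shows "card (facet_sets (edge_vectors B)) = 2"
proof -
  obtain f where f: "inj_on f {1, 2 :: nat}" "edges B = {{f 1, f 2}}"
    using assms unfolding graph_iso_def single_edge_def by (auto simp: bij_betw_def)
  let ?z = "std_basis (f 1) - std_basis (f 2)"
  have "f 1 \<noteq> f 2" using f(1) by (auto simp: inj_on_def)
  then have "Poly_Mapping.lookup ?z (f 1) = 1" by (simp add: lookup_minus lookup_std_basis)
  then have "?z \<noteq> 0" by (metis lookup_zero zero_neq_one)
  moreover have "edge_vectors B = {?z, - ?z}"
    unfolding edge_vectors_def f(2) by (auto simp: doubleton_eq_iff)
  ultimately show ?thesis using card_facet_sets_pair by metis
qed

section \<open>Isomorphic copies and existence of wedges\<close>

lemma graph_iso_refl: "graph_iso G G"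
  unfolding graph_iso_def by (intro exI[of _ id]) auto

lemma graph_iso_trans:
  assumes "graph_iso G H" "graph_iso H K"
  shows "graph_iso G K"
proof -
  obtain f where f: "bij_betw f (verts G) (verts H)" "edges H = (\<lambda>e. f ` e) ` edges G"
    using assms(1) unfolding graph_iso_def by blast
  obtain h where h: "bij_betw h (verts H) (verts K)" "edges K = (\<lambda>e. h ` e) ` edges H"
    using assms(2) unfolding graph_iso_def by blast
  show ?thesis
    unfolding graph_iso_def
    using bij_betw_trans[OF f(1) h(1)] f(2) h(2) by (intro exI[of _ "h \<circ> f"]) (simp add: image_image image_comp)
qed

lemma graph_iso_image:
  "inj_on f (verts G) \<Longrightarrow> graph_iso G (f ` verts G, (\<lambda>e. f ` e) ` edges G)"
  unfolding graph_iso_def by (intro exI[of _ f]) (simp add: bij_betw_def)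

text \<open>Both parts are transported along the isomorphism. Attaching a single edge uses an
  arbitrary copy of a wedge, which is thereby a wedge again.\<close>

lemma is_wedge_iso:
  assumes "is_wedge G H W" "graph_iso W W'"
  shows "is_wedge G H W'"
proof -
  obtain A B x where AB: "graph_iso G A" "graph_iso H B" "verts A \<inter> verts B = {x}"
    "W = (verts A \<union> verts B, edges A \<union> edges B)"
    using assms(1) unfolding is_wedge_def by blast
  obtain f where f: "bij_betw f (verts W) (verts W')" "edges W' = (\<lambda>e. f ` e) ` edges W"
    using assms(2) unfolding graph_iso_def by blast
  have inj: "inj_on f (verts A \<union> verts B)" and img: "verts W' = f ` (verts A \<union> verts B)"
    using f(1) AB(4) by (auto simp: bij_betw_def)
  let ?A = "(f ` verts A, (\<lambda>e. f ` e) ` edges A)" and ?B = "(f ` verts B, (\<lambda>e. f ` e) ` edges B)"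
  have "graph_iso G ?A" "graph_iso H ?B"
    using inj_on_subset[OF inj] graph_iso_trans[OF AB(1) graph_iso_image[of f A]]
      graph_iso_trans[OF AB(2) graph_iso_image[of f B]] by simp_all
  moreover have "verts ?A \<inter> verts ?B = {f x}"
    using inj_on_image_Int[OF inj, of "verts A" "verts B"] AB(3) by simp
  moreover have "W' = (verts ?A \<union> verts ?B, edges ?A \<union> edges ?B)"
    using img f(2) AB(4) by (simp add: prod_eq_iff image_Un)
  ultimately show ?thesis unfolding is_wedge_def by blast
qed

text \<open>Shifting \<open>H\<close> by \<open>a - 1\<close> places its vertex 1 on the vertex
  \<open>a\<close> of \<open>G\<close>, so the union fills an initial interval.\<close>

lemma wedge_exists:
  assumes G: "verts G = {1..a}" and H: "verts H = {1..b}" and ab: "a \<ge> 1" "b \<ge> 1"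
  shows "\<exists>W :: nat graph. is_wedge G H W \<and> verts W = {1..a + b - 1}"
proof -
  let ?f = "\<lambda>i. i + (a - 1)"
  let ?B = "(?f ` verts H, (\<lambda>e. ?f ` e) ` edges H)"
  have img: "?f ` {1..b} = {a..a + b - 1}"
    using ab by (subst image_add_atLeastAtMost') (simp add: add.commute)
  have "graph_iso H ?B" by (rule graph_iso_image) simp
  moreover have "verts G \<inter> verts ?B = {a}"
    using G H img ab by auto
  moreover have "verts G \<union> verts ?B = {1..a + b - 1}"
    using G H img ab by auto
  ultimately show ?thesis
    unfolding is_wedge_def using graph_iso_refl[of G]
    by (intro exI[of _ "(verts G \<union> verts ?B, edges G \<union> edges ?B)"] conjI exI[of _ G] exI[of _ ?B] exI[of _ a])
      simp_all
qed

section \<open>Growth of the cycle factors and counts for the wedges\<close>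

text \<open>This is the factor \<open>a l\<close> of the opening comment. Its value 1 at
  \<open>l = 0\<close> fits the closed formulas for \<open>n = 3\<close> and
  \<open>n = 4\<close>.\<close>

definition odd_cycle_facets :: "nat \<Rightarrow> nat" where
  "odd_cycle_facets l = (2 * l + 1) * ((2 * l) choose l)"

text \<open>Consecutive values have ratio \<open>2 * (2 * t + 3) / (t + 1)\<close>, which is at
  least 4. The denominator is cleared by working with multiples of \<open>Suc t\<close>.\<close>

lemma odd_cycle_facets_growth: "4 * odd_cycle_facets t \<le> odd_cycle_facets (Suc t)"
proof -
  have "Suc t * ((2 * Suc t) choose Suc t) = (2 * Suc t) * ((2 * t + 1) choose t)"
    using Suc_times_binomial_eq[of "2 * t + 1" t] by (simp add: mult.commute)
  \<comment> \<open>Symmetry replaces the lower index \<open>t\<close> by \<open>t + 1\<close>, so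
    that absorption applies a second time.\<close>
  moreover have "Suc t * ((2 * t + 1) choose t) = (2 * t + 1) * ((2 * t) choose t)"
    using Suc_times_binomial_eq[of "2 * t" t] binomial_symmetric[of t "2 * t + 1"]
    by (simp add: mult.commute)
  ultimately have "Suc t * ((2 * Suc t) choose Suc t) = 2 * odd_cycle_facets t"
    unfolding odd_cycle_facets_def by simp
  then have "(2 * t + 3) * (Suc t * ((2 * Suc t) choose Suc t)) = (2 * t + 3) * (2 * odd_cycle_facets t)"
    by simp
  moreover have "Suc t * odd_cycle_facets (Suc t) = (2 * t + 3) * (Suc t * ((2 * Suc t) choose Suc t))"
    unfolding odd_cycle_facets_def by (simp add: algebra_simps)
  ultimately have "Suc t * odd_cycle_facets (Suc t) = (2 * t + 3) * (2 * odd_cycle_facets t)"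
    by simp
  also have "\<dots> \<ge> Suc t * (4 * odd_cycle_facets t)"
    by (simp add: algebra_simps)
  finally show ?thesis by (simp only: Suc_mult_le_cancel1)
qed

lemma odd_cycle_facets_pos: "odd_cycle_facets t > 0"
  unfolding odd_cycle_facets_def by simp

lemma odd_cycle_facets_gt_1: "t \<ge> 1 \<Longrightarrow> odd_cycle_facets t > 1"
  using odd_cycle_facets_growth[of "t - 1"] odd_cycle_facets_pos[of "t - 1"] by (cases t) auto

lemma card_facet_sets_wedge_odd_cycles:
  assumes "is_wedge (cycle_graph (2 * s + 1)) (cycle_graph (2 * t + 1)) W"
  shows "card (facet_sets (edge_vectors W)) = odd_cycle_facets s * odd_cycle_facets t"
  using card_facet_sets_wedge[OF assms finite_graph_cycle finite_graph_cycle
      card_facet_sets_odd_cycle card_facet_sets_odd_cycle]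
  unfolding odd_cycle_facets_def by simp

text \<open>With \<open>s \<ge> 1\<close> the product exceeds 1, as the passage from
  \<open>facet_sets\<close> to facets requires.\<close>

lemma num_facets_wedge_odd_cycles:
  assumes W: "is_wedge (cycle_graph (2 * s + 1)) (cycle_graph (2 * t + 1)) W" and "s \<ge> 1"
  shows "num_facets (sym_edge_polytope W) = odd_cycle_facets s * odd_cycle_facets t"
proof -
  have "finite_graph W" using finite_graph_wedge[OF W] finite_graph_cycle by simp
  moreover have "odd_cycle_facets s * odd_cycle_facets t > 1"
    using odd_cycle_facets_gt_1[OF assms(2)] odd_cycle_facets_pos[of t]
      mult_le_mono2[of 1 "odd_cycle_facets t" "odd_cycle_facets s"] by linarith
  ultimately show ?thesis
    using num_facets_sym_edge_polytope card_facet_sets_wedge_odd_cycles[OF W] by simp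
qed

lemma num_facets_wedge_odd_cycles_edge:
  assumes W: "is_wedge (cycle_graph (2 * s + 1)) (cycle_graph (2 * t + 1)) W" and G: "is_wedge W single_edge G"
  shows "num_facets (sym_edge_polytope G) = 2 * (odd_cycle_facets s * odd_cycle_facets t)"
proof -
  have W_fin: "finite_graph W" using finite_graph_wedge[OF W] finite_graph_cycle by simp
  have "finite_graph G" using finite_graph_wedge[OF G W_fin finite_graph_single_edge] .
  moreover have "card (facet_sets (edge_vectors G)) = odd_cycle_facets s * odd_cycle_facets t * 2"
    using card_facet_sets_wedge_odd_cycles[OF is_wedge_iso[OF W]] card_facet_sets_single_edge
    by (intro card_facet_sets_wedge[OF G W_fin finite_graph_single_edge]) auto
  moreover have "odd_cycle_facets s * odd_cycle_facets t > 0"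
    using odd_cycle_facets_pos[of s] odd_cycle_facets_pos[of t] by simp
  then have "odd_cycle_facets s * odd_cycle_facets t * 2 > 1" by linarith
  ultimately show ?thesis using num_facets_sym_edge_polytope[of G] by simp
qed

section \<open>Evaluation of \<open>M\<close> and the inequality\<close>

text \<open>The description operator needs existence, given by the graph \<open>G\<close>, and a
  count common to all admissible graphs.\<close>

lemma M_eqI:
  assumes "n \<ge> 5" "M_graph n G" "\<And>G. M_graph n G \<Longrightarrow> num_facets (sym_edge_polytope G) = N"
  shows "M n = N"
proof -
  have "(THE N. \<exists>G. M_graph n G \<and> N = num_facets (sym_edge_polytope G)) = N"
    using assms(2,3) by (intro the_equality) blast+
  then show ?thesis unfolding M_def using assms(1) by simp
qed

lemma odd_cycle_wedge_exists:
  "\<exists>W. is_wedge (cycle_graph (2 * s + 1)) (cycle_graph (2 * t + 1)) W \<and> verts W = {1..2 * s + 2 * t + 1}"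
  using wedge_exists[of "cycle_graph (2 * s + 1)" "2 * s + 1" "cycle_graph (2 * t + 1)" "2 * t + 1"]
  by (auto simp: cycle_graph_def)

lemma odd_cycle_wedge_edge_exists:
  "\<exists>W G. is_wedge (cycle_graph (2 * s + 1)) (cycle_graph (2 * t + 1)) W \<and> is_wedge W single_edge G \<and>
     verts G = {1..2 * s + 2 * t + 2}"
proof -
  obtain W where W: "is_wedge (cycle_graph (2 * s + 1)) (cycle_graph (2 * t + 1)) W"
    "verts W = {1..2 * s + 2 * t + 1}"
    using odd_cycle_wedge_exists by blast
  have "verts single_edge = {1..2}" unfolding single_edge_def by auto
  then show ?thesis
    using wedge_exists[OF W(2), of single_edge 2] W(1) by (simp del: split_paired_Ex) blast
qed

text \<open>The pair \<open>(s, t)\<close> with \<open>s = t\<close> or \<open>s = t + 1\<close> encodes the two cycle lengths \<open>2 * s + 1\<close>,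
  \<open>2 * t + 1\<close> of the definition: \<open>k = s + t + 1\<close>, which is odd in the first case and even in the
  second.\<close>

lemma M_graph_odd_iff:
  assumes "s = t \<or> s = Suc t"
  shows "M_graph (2 * s + 2 * t + 1) G \<longleftrightarrow>
    verts G = {1..2 * s + 2 * t + 1} \<and> is_wedge (cycle_graph (2 * s + 1)) (cycle_graph (2 * t + 1)) G"
proof -
  have "2 * s + 2 * t + 1 + 1 = 2 * k \<longleftrightarrow> k = s + t + 1" "2 * s + 2 * t + 1 \<noteq> 2 * k" for k
    by presburger+
  then show ?thesis unfolding M_graph_def using assms by (auto simp: mult_2 ex_disj_distrib simp del: split_paired_Ex)
qed

lemma M_graph_even_iff:
  assumes "s = t \<or> s = Suc t"
  shows "M_graph (2 * s + 2 * t + 2) G \<longleftrightarrow> verts G = {1..2 * s + 2 * t + 2} \<and>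
    (\<exists>W. is_wedge (cycle_graph (2 * s + 1)) (cycle_graph (2 * t + 1)) W \<and> is_wedge W single_edge G)"
proof -
  have "2 * s + 2 * t + 2 = 2 * k \<longleftrightarrow> k = s + t + 1" "2 * s + 2 * t + 2 + 1 \<noteq> 2 * k" for k
    by presburger+
  then show ?thesis unfolding M_graph_def using assms by (auto simp: mult_2 ex_disj_distrib simp del: split_paired_Ex)
qed

lemma M_odd:
  assumes "s = t \<or> s = Suc t" "s \<ge> 1"
  shows "M (2 * s + 2 * t + 1) = odd_cycle_facets s * odd_cycle_facets t"
proof (cases "t = 0")
  case True
  \<comment> \<open>This is \<open>n = 3\<close>, where \<open>M\<close> is given by the closed
    formula.\<close>
  then have "s = 1" using assms by auto
  then show ?thesis using True by (simp add: M_def odd_cycle_facets_def)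
next
  case False
  obtain G where "M_graph (2 * s + 2 * t + 1) G"
    using odd_cycle_wedge_exists[of s t] M_graph_odd_iff[OF assms(1)] by blast
  then show ?thesis
    using False assms(2) M_graph_odd_iff[OF assms(1)] num_facets_wedge_odd_cycles
    by (intro M_eqI) auto
qed

lemma M_even:
  assumes "s = t \<or> s = Suc t" "s \<ge> 1"
  shows "M (2 * s + 2 * t + 2) = 2 * (odd_cycle_facets s * odd_cycle_facets t)"
proof (cases "t = 0")
  case True
  then have "s = 1" using assms by auto
  then show ?thesis using True by (simp add: M_def odd_cycle_facets_def)
next
  case False
  obtain G where "M_graph (2 * s + 2 * t + 2) G"
    using odd_cycle_wedge_edge_exists[of s t] M_graph_even_iff[OF assms(1)] by blast
  moreover have "num_facets (sym_edge_polytope G) = 2 * (odd_cycle_facets s * odd_cycle_facets t)"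
    if "M_graph (2 * s + 2 * t + 2) G" for G
    using that M_graph_even_iff[OF assms(1)] num_facets_wedge_odd_cycles_edge by blast
  ultimately show ?thesis
    using False assms(2) by (intro M_eqI) auto
qed

theorem theorem3p8:
  fixes n :: nat
  assumes "n \<ge> 3"
  shows "2 * M n \<le> M (n + 1)"
proof -
  consider (odd) s t where "n = 2 * s + 2 * t + 1" "s = t \<or> s = Suc t" "s \<ge> 1"
    | (even) s t where "n = 2 * s + 2 * t + 2" "s = t \<or> s = Suc t" "s \<ge> 1"
  proof -
    \<comment> \<open>Parity of \<open>n\<close> decides whether an edge is attached; the residue
      modulo 4 also decides between \<open>s = t\<close> and \<open>s = Suc t\<close>.\<close>
    define q where "q = n div 4"
    have "n mod 4 < 4" and n: "n = 4 * q + n mod 4" unfolding q_def by simp_all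
    then consider "n = 4 * q" | "n = 4 * q + 1" | "n = 4 * q + 2" | "n = 4 * q + 3"
      by linarith
    then show ?thesis
    proof cases
      case 1
      then show ?thesis using assms by (intro that(2)[of q "q - 1"]) auto
    next
      case 2
      then show ?thesis using assms by (intro that(1)[of q q]) auto
    next
      case 3
      then show ?thesis using assms by (intro that(2)[of q q]) auto
    next
      case 4
      then show ?thesis by (intro that(1)[of "Suc q" q]) auto
    qed
  qed
  then show ?thesis
  proof cases
    case odd
    \<comment> \<open>Passing from odd to even \<open>n\<close> only attaches an edge, so equality
      holds.\<close>
    then show ?thesis using M_odd[of s t] M_even[of s t] by simp
  next
    case even
    \<comment> \<open>Passing from even to odd \<open>n\<close> trades the edge for two more edges
      in the cycle of index \<open>t\<close>. The pair \<open>(s, t)\<close> becomes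
      \<open>(Suc t, s)\<close>, which again has equal or consecutive entries.\<close>
    have "2 * M n = 4 * (odd_cycle_facets s * odd_cycle_facets t)"
      using even M_even[of s t] by simp
    also have "\<dots> \<le> odd_cycle_facets (Suc t) * odd_cycle_facets s"
      using odd_cycle_facets_growth[of t] by (simp add: mult.left_commute)
    also have "\<dots> = M (n + 1)"
    proof -
      have "2 * Suc t + 2 * s + 1 = n + 1" using even(1) by simp
      moreover have "Suc t = s \<or> Suc t = Suc s" using even(2) by auto
      ultimately show ?thesis using M_odd[of "Suc t" s] by simp
    qed
    finally show ?thesis .
  qed
qed

end
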